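(* Let $\psi_0(W)$ be defined by $$\psi_0(W)=\max\left[\min\left(1,\ \frac1{a(W)}\right),\ \frac{1}{a(W)}\left(1-\frac{n(1+W)}{n+p+2}\right)\right].$$ Then $$\hat R(\psi_0;\boldsymbol\delta_\phi)=\frac{pS}{n}\bigl(1-a(W)\psi_0(W)\bigr)=\min\left[\max\bigl(\hat R_0(\boldsymbol\delta_\phi),0\bigr),\ \frac{pS(1+W)}{n+p+2}\right]$$ improves on $\hat R_0(\boldsymbol\delta_\phi)$, as an estimator of $R(\boldsymbol\delta_\phi)$, under the loss function $L(\hat R;R(\boldsymbol\delta_\phi))=(\hat R-R(\boldsymbol\delta_\phi))^2$.
   Context: Let $p\ge 3$, and let $\boldsymbol X\sim N_p(\boldsymbol\theta,\sigma^2 I_p)$ and $S\sim\sigma^2\chi^2_n$ be independent, where $\boldsymbol\theta$ and $\sigma^2$ are both unknown and $\chi^2_n$ is a chi-square variable with $n$ degrees of freedom. Put $W=\|\boldsymbol X\|^2/S$. Consider a shrinkage estimator $\boldsymbol\delta_\phi=\left(1-\frac{\phi(W)}{W}\right)\boldsymbol X$ of $\boldsymbol\theta$ which improves on $\boldsymbol X$ under squared error loss, where $\phi(\cdot)$ and $\phi'(\cdot)$ are assumed to be finite. Its mean squared error is $R(\boldsymbol\delta_\phi)=E\|\boldsymbol\delta_\phi-\boldsymbol\theta\|^2$; since $\boldsymbol\delta_\phi$ improves on $\boldsymbol X$, $R(\boldsymbol\delta_\phi)\le p\sigma^2$. Let $\hat R_0(\boldsymbol\delta_\phi)$ denote the uniformly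 minimum variance unbiased estimator of $R(\boldsymbol\delta_\phi)$. When $\phi$ and $\phi'$ are continuous it is expressed by $$\hat R_0(\boldsymbol\delta_\phi)=\frac{pS}{n}-S\,g(W)+\frac{S\phi^2(W)}{W},\qquad g(W)=W^{n/2}\int_W^\infty t^{-n/2}\,\frac{h(t)}{t}\,dt,\qquad h(W)=(p-2)\frac{\phi(W)}{W}+2\phi'(W).$$ Set $a(W)=\frac np\left(g(W)-\frac{\phi^2(W)}{W}\right)$, so that $\hat R_0(\boldsymbol\delta_\phi)=\frac{pS}{n}(1-a(W))$. "Improves on" under a loss refers to comparison of risks (expected losses).
   Formalization: The equality of the ψ₀ form with the min/max form is stated only where a(W)>0, and the ψ₀ form's improvement only if a(W)>0 almost surely (the equality can fail for a(W)<0; 1/a(W) is undefined at 0). The min/max estimator's improvement is unconditional. *)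

theory Defs
  imports "HOL-Probability.Probability"
begin

text \<open>
  The observation is a pair \<open>(x, s)\<close> with \<open>x\<close> in \<open>real ^ 'p\<close> and \<open>s\<close> real. The unknown parameter
  is \<open>(\<theta>, \<sigma>)\<close> with \<open>\<sigma> > 0\<close>, where \<open>\<sigma>\<close> is the standard deviation, so that the variance is
  \<open>\<sigma>\<^sup>2\<close>.
\<close>

definition isotropic_normal :: "real ^ 'p \<Rightarrow> real \<Rightarrow> (real ^ 'p) measure" where
  "isotropic_normal \<theta> \<sigma> =
     density lborel (\<lambda>x. ennreal (\<Prod>i\<in>UNIV. normal_density (\<theta> $ i) \<sigma> (x $ i)))"

definition chi_square :: "nat \<Rightarrow> real measure" where
  "chi_square n = density lborel (\<lambda>t. ennreal (if t \<le> 0 then 0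
     else t powr (real n / 2 - 1) * exp (- t / 2) / (2 powr (real n / 2) * Gamma (real n / 2))))"

text \<open>Independence of the two components is expressed by the product measure.\<close>

definition model :: "nat \<Rightarrow> real ^ 'p \<Rightarrow> real \<Rightarrow> ((real ^ 'p) \<times> real) measure" where
  "model n \<theta> \<sigma> =
     isotropic_normal \<theta> \<sigma> \<Otimes>\<^sub>M distr (chi_square n) borel (\<lambda>t. \<sigma>\<^sup>2 * t)"

text \<open>
  Risks are taken in the extended nonnegative reals, so that an infinite risk is not confused
  with the value 0 that a Bochner integral would return.
\<close>

definition risk :: "'z measure \<Rightarrow> ('z \<Rightarrow> real) \<Rightarrow> ennreal" where
  "risk M l = (\<integral>\<^sup>+ z. ennreal (l z) \<partial>M)"

text \<open>
  \<open>improves_on P L d d'\<close>: under the loss \<open>L\<close> and the family \<open>P\<close>, the risk of \<open>d\<close> is at most that of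
  \<open>d'\<close> whatever the parameter.
\<close>

definition improves_on ::
  "('v \<Rightarrow> real \<Rightarrow> 'z measure) \<Rightarrow> ('v \<Rightarrow> real \<Rightarrow> 'd \<Rightarrow> real) \<Rightarrow> ('z \<Rightarrow> 'd) \<Rightarrow> ('z \<Rightarrow> 'd) \<Rightarrow> bool" where
  "improves_on P L d d' \<longleftrightarrow>
     (\<forall>\<theta> \<sigma>. 0 < \<sigma> \<longrightarrow>
        risk (P \<theta> \<sigma>) (\<lambda>z. L \<theta> \<sigma> (d z)) \<le> risk (P \<theta> \<sigma>) (\<lambda>z. L \<theta> \<sigma> (d' z)))"

definition W_stat :: "(real ^ 'p) \<times> real \<Rightarrow> real" where
  "W_stat z = (norm (fst z))\<^sup>2 / snd z"

definition shrink :: "(real \<Rightarrow> real) \<Rightarrow> (real ^ 'p) \<times> real \<Rightarrow> real ^ 'p" where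
  "shrink \<phi> z = (1 - \<phi> (W_stat z) / W_stat z) *\<^sub>R fst z"

definition squared_error :: "real ^ 'p \<Rightarrow> real \<Rightarrow> real ^ 'p \<Rightarrow> real" where
  "squared_error \<theta> \<sigma> d = (norm (d - \<theta>))\<^sup>2"

definition mse :: "nat \<Rightarrow> (real \<Rightarrow> real) \<Rightarrow> real ^ 'p \<Rightarrow> real \<Rightarrow> real" where
  "mse n \<phi> \<theta> \<sigma> =
     enn2real (risk (model n \<theta> \<sigma>) (\<lambda>z. squared_error \<theta> \<sigma> (shrink \<phi> z)))"

definition mse_loss :: "nat \<Rightarrow> (real \<Rightarrow> real) \<Rightarrow> real ^ 'p \<Rightarrow> real \<Rightarrow> real \<Rightarrow> real" where
  "mse_loss n \<phi> \<theta> \<sigma> r = (r - mse n \<phi> \<theta> \<sigma>)\<^sup>2"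

definition h_fun :: "nat \<Rightarrow> (real \<Rightarrow> real) \<Rightarrow> real \<Rightarrow> real" where
  "h_fun p \<phi> w = (real p - 2) * \<phi> w / w + 2 * deriv \<phi> w"

text \<open>
  The gauge integral also covers the case where the integral to infinity converges only
  conditionally.
\<close>

definition g_fun :: "nat \<Rightarrow> nat \<Rightarrow> (real \<Rightarrow> real) \<Rightarrow> real \<Rightarrow> real" where
  "g_fun n p \<phi> w =
     w powr (real n / 2) * integral {w..} (\<lambda>t. t powr (- real n / 2) * (h_fun p \<phi> t / t))"

definition a_fun :: "nat \<Rightarrow> nat \<Rightarrow> (real \<Rightarrow> real) \<Rightarrow> real \<Rightarrow> real" where
  "a_fun n p \<phi> w = real n / real p * (g_fun n p \<phi> w - (\<phi> w)\<^sup>2 / w)"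

text \<open>
  For continuously differentiable \<open>\<phi>\<close>, the following is the closed form of the uniformly minimum
  variance unbiased estimator of \<open>mse n \<phi>\<close>.
\<close>

definition R0_hat :: "nat \<Rightarrow> (real \<Rightarrow> real) \<Rightarrow> (real ^ 'p) \<times> real \<Rightarrow> real" where
  "R0_hat n \<phi> z =
     real CARD('p) * snd z / real n - snd z * g_fun n CARD('p) \<phi> (W_stat z) + snd z * (\<phi> (W_stat z))\<^sup>2 / W_stat z"

definition psi0 :: "nat \<Rightarrow> nat \<Rightarrow> (real \<Rightarrow> real) \<Rightarrow> real \<Rightarrow> real" where
  "psi0 n p \<phi> w =
     max (min 1 (1 / a_fun n p \<phi> w))
         (1 / a_fun n p \<phi> w * (1 - real n * (1 + w) / (real n + real p + 2)))"

definition R_hat :: "nat \<Rightarrow> (real \<Rightarrow> real) \<Rightarrow> (real \<Rightarrow> real) \<Rightarrow> (real ^ 'p) \<times> real \<Rightarrow> real" where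
  "R_hat n \<phi> \<psi> z = real CARD('p) * snd z / real n * (1 - a_fun n CARD('p) \<phi> (W_stat z) * \<psi> (W_stat z))"

definition R0_trunc :: "nat \<Rightarrow> (real \<Rightarrow> real) \<Rightarrow> (real ^ 'p) \<times> real \<Rightarrow> real" where
  "R0_trunc n \<phi> z =
     min (max (R0_hat n \<phi> z) 0)
         (real CARD('p) * snd z * (1 + W_stat z) / (real n + real CARD('p) + 2))"

end

(* Put V = |x|^2 + s. Up to the sign of x, the density is homogeneous apart from the factors
   exp(-V / (2 sigma^2)) and cosh(x . theta / sigma^2). Substituting (x, s) -> (l x, l^2 s) with
   l <= 1 and using that cosh increases with |x|, one gets for nonnegative f that is even in x and
   homogeneous of degree 2, by letting l -> 1,
     E[f V] >= (n + p + 2) sigma^2 E[f].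
   Write a nonnegative estimator as U = V u(W) and its truncation as M = V min(u(W), c), where
   c = p / (n + p + 2). Then (U - R)^2 + 2 R (U - M) >= (M - R)^2 + 2 c V (U - M), and the inequality
   for f = U - M together with R <= p sigma^2 shows that truncating at c V does not increase the
   risk. Truncating below at 0 does not either, because R >= 0. *)

theory Submission
  imports Defs
begin

section \<open>Parabolic changes of variables in Lebesgue measure\<close>

lemma nn_integral_lborel_parabolic_scaling:
  fixes F :: "('a::euclidean_space) \<times> real \<Rightarrow> ennreal"
  assumes F[measurable]: "F \<in> borel_measurable borel" and c: "c \<noteq> 0"
  shows "(\<integral>\<^sup>+ z. F z \<partial>lborel) =
    ennreal (\<bar>c\<bar> ^ (DIM('a) + 2)) * (\<integral>\<^sup>+ z. F (c *\<^sub>R fst z, c\<^sup>2 * snd z) \<partial>lborel)"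
proof -
  have pw: "ennreal (\<bar>c\<bar> ^ (DIM('a) + 2)) = ennreal (\<bar>c\<bar> ^ DIM('a)) * ennreal (c\<^sup>2)"
    by (simp only: power_add power2_abs) (simp add: ennreal_mult)
  have F'[measurable]: "F \<in> borel_measurable (borel \<Otimes>\<^sub>M borel)"
    using F by (simp add: borel_prod)
  have "(\<lambda>z. F (c *\<^sub>R fst z, c\<^sup>2 * snd z)) \<in> borel_measurable (borel \<Otimes>\<^sub>M borel)"
    by measurable
  then have G: "(\<lambda>z. F (c *\<^sub>R fst z, c\<^sup>2 * snd z)) \<in> borel_measurable borel"
    by (simp add: borel_prod)
  have "(\<integral>\<^sup>+ z. F z \<partial>lborel) = (\<integral>\<^sup>+ x. (\<integral>\<^sup>+ s. F (x, s) \<partial>lborel) \<partial>lborel)"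
    by (subst lborel.nn_integral_fst) (simp_all add: lborel_prod)
  also have "\<dots> = (\<integral>\<^sup>+ x. ennreal (c\<^sup>2) * (\<integral>\<^sup>+ s. F (x, c\<^sup>2 * s) \<partial>lborel) \<partial>lborel)"
    using c by (subst nn_integral_real_affine[of _ "c\<^sup>2" 0]) simp_all
  also have "\<dots> = ennreal (\<bar>c\<bar> ^ DIM('a)) *
      (\<integral>\<^sup>+ x. ennreal (c\<^sup>2) * (\<integral>\<^sup>+ s. F (c *\<^sub>R x, c\<^sup>2 * s) \<partial>lborel) \<partial>lborel)"
    by (subst lborel_affine[OF c, of 0])
      (simp add: nn_integral_density nn_integral_distr nn_integral_cmult mult.left_commute)
  also have "\<dots> = ennreal (\<bar>c\<bar> ^ (DIM('a) + 2)) *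
      (\<integral>\<^sup>+ x. (\<integral>\<^sup>+ s. F (c *\<^sub>R x, c\<^sup>2 * s) \<partial>lborel) \<partial>lborel)"
    by (subst nn_integral_cmult) (simp, simp only: pw mult.assoc)
  also have "(\<integral>\<^sup>+ x. (\<integral>\<^sup>+ s. F (c *\<^sub>R x, c\<^sup>2 * s) \<partial>lborel) \<partial>lborel) =
      (\<integral>\<^sup>+ z. F (c *\<^sub>R fst z, c\<^sup>2 * snd z) \<partial>lborel)"
    using lborel.nn_integral_fst[of "\<lambda>z. F (c *\<^sub>R fst z, c\<^sup>2 * snd z)" lborel] G
    by (simp add: lborel_prod)
  finally show ?thesis .
qed

lemma nn_integral_lborel_reflect_fst:
  fixes F :: "('a::euclidean_space) \<times> real \<Rightarrow> ennreal"
  assumes F[measurable]: "F \<in> borel_measurable borel"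
  shows "(\<integral>\<^sup>+ z. F z \<partial>lborel) = (\<integral>\<^sup>+ z. F (- fst z, snd z) \<partial>lborel)"
  using nn_integral_lborel_parabolic_scaling[OF F, of "-1"] by simp

section \<open>The sampling kernel and its moment inequality\<close>

text \<open>The sampling density up to a constant factor, for \<open>q = 1 / (2 * \<sigma>\<^sup>2)\<close> and
  \<open>b = \<theta> / \<sigma>\<^sup>2\<close>.\<close>

definition kern :: "nat \<Rightarrow> real \<Rightarrow> real ^ 'p \<Rightarrow> (real ^ 'p) \<times> real \<Rightarrow> real" where
  "kern n q b z = (if snd z \<le> 0 then 0 else snd z powr (real n / 2 - 1) *
     exp (- q * ((norm (fst z))\<^sup>2 + snd z)) * exp (b \<bullet> fst z))"

lemma kern_nonneg: "0 \<le> kern n q b z"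
  by (simp add: kern_def)

lemma measurable_kern[measurable]: "kern n q b \<in> borel_measurable borel"
  unfolding kern_def borel_prod[symmetric] by measurable

text \<open>The exponent of the first exponential is homogeneous of degree 2 and that of the second
  of degree 1, so dilating the argument amounts to rescaling \<open>q\<close> and \<open>b\<close>;
  the power of \<open>snd z\<close> supplies the remaining factor.\<close>

lemma kern_scale:
  assumes "0 < c"
  shows "kern n q b (c *\<^sub>R fst z, c\<^sup>2 * snd z) = c powr (real n - 2) * kern n (q * c\<^sup>2) (c *\<^sub>R b) z"
proof -
  have "(c\<^sup>2) powr (real n / 2 - 1) = c powr (real n - 2)"
    using assms powr_powr[of c 2 "real n / 2 - 1"] by (simp add: powr_numeral algebra_simps)
  then show ?thesis
    using assms
    by (auto simp: kern_def powr_mult mult_le_0_iff power_mult_distrib algebra_simps)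
qed

lemma kern_reflect: "kern n q b (- fst z, snd z) = kern n q (- b) z"
  by (simp add: kern_def)

lemma cosh_mono_abs:
  fixes y :: real assumes "0 \<le> l" "l \<le> 1"
  shows "exp (l * y) + exp (- (l * y)) \<le> exp y + exp (- y)"
proof -
  have "cosh (l * \<bar>y\<bar>) \<le> cosh \<bar>y\<bar>"
    by (subst cosh_real_nonneg_le_iff) (use assms in \<open>auto simp: mult_left_le_one_le\<close>)
  moreover have "cosh (l * \<bar>y\<bar>) = cosh (l * y)" by (cases "0 \<le> y") auto
  ultimately have "cosh (l * y) \<le> cosh y" by simp
  then show ?thesis by (simp add: cosh_field_def)
qed

text \<open>Against an even function the kernel can be averaged with its reflection, which replaces
  the factor exp(b . x) by cosh(b . x). The latter grows pointwise when \<open>b\<close> is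
  lengthened.\<close>

lemma nn_integral_even_kern_mono:
  fixes f :: "(real ^ 'p) \<times> real \<Rightarrow> ennreal"
  assumes f[measurable]: "f \<in> borel_measurable borel"
    and even: "\<And>z. f (- fst z, snd z) = f z"
    and l: "0 \<le> l" "l \<le> 1"
  shows "(\<integral>\<^sup>+ z. f z * ennreal (kern n q (l *\<^sub>R b) z) \<partial>lborel)
      \<le> (\<integral>\<^sup>+ z. f z * ennreal (kern n q b z) \<partial>lborel)"
proof -
  have sym: "2 * (\<integral>\<^sup>+ z. f z * ennreal (kern n q b z) \<partial>lborel) =
    (\<integral>\<^sup>+ z. f z * ennreal (kern n q b z + kern n q (- b) z) \<partial>lborel)" for b
  proof -
    have "(\<integral>\<^sup>+ z. f z * ennreal (kern n q b z) \<partial>lborel)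
        = (\<integral>\<^sup>+ z. f z * ennreal (kern n q (- b) z) \<partial>lborel)"
      by (subst nn_integral_lborel_reflect_fst) (simp_all add: even kern_reflect)
    then show ?thesis
      by (simp add: kern_nonneg ennreal_plus distrib_left nn_integral_add mult_2)
  qed
  \<comment> \<open>At \<open>b = 0\<close> the kernel is the weight common to all four
    terms.\<close>
  have "kern n q (l *\<^sub>R b) z + kern n q (- (l *\<^sub>R b)) z \<le> kern n q b z + kern n q (- b) z" for z
    using mult_left_mono[OF cosh_mono_abs[OF l, of "b \<bullet> fst z"], of "kern n q 0 z"] kern_nonneg[of n q 0 z]
    by (auto simp: kern_def algebra_simps split: if_splits)
  then have "2 * (\<integral>\<^sup>+ z. f z * ennreal (kern n q (l *\<^sub>R b) z) \<partial>lborel)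
      \<le> 2 * (\<integral>\<^sup>+ z. f z * ennreal (kern n q b z) \<partial>lborel)"
    unfolding sym by (intro nn_integral_mono mult_left_mono ennreal_leI) auto
  then show ?thesis by (simp add: ennreal_mult_le_mult_iff)
qed

text \<open>Dilating by \<open>l\<close> turns \<open>q / l\<^sup>2\<close> back into
  \<open>q\<close> and shrinks \<open>b\<close> to \<open>l *\<^sub>R b\<close>, and evenness allows
  the shrunken vector to be replaced by \<open>b\<close>. The exponent adds
  \<open>CARD('p) + 2\<close> from the Jacobian, 2 from the homogeneity of \<open>f\<close> and
  \<open>n - 2\<close> from the kernel.\<close>

lemma nn_integral_kern_scaling_le:
  fixes f :: "(real ^ 'p) \<times> real \<Rightarrow> ennreal"
  assumes f[measurable]: "f \<in> borel_measurable borel"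
    and even: "\<And>z. f (- fst z, snd z) = f z"
    and hom: "\<And>c z. 0 < c \<Longrightarrow> f (c *\<^sub>R fst z, c\<^sup>2 * snd z) = ennreal (c\<^sup>2) * f z"
    and l: "0 < l" "l \<le> 1"
  shows "(\<integral>\<^sup>+ z. f z * ennreal (kern n (q / l\<^sup>2) b z) \<partial>lborel)
      \<le> ennreal (l ^ (n + CARD('p) + 2)) * (\<integral>\<^sup>+ z. f z * ennreal (kern n q b z) \<partial>lborel)"
proof -
  have "l ^ (CARD('p) + 2) * (l\<^sup>2 * l powr (real n - 2)) = l ^ (n + CARD('p) + 2)"
    using l by (simp add: powr_diff powr_realpow power_add powr_numeral field_simps)
  then have pw: "ennreal (l ^ (CARD('p) + 2)) * (ennreal (l\<^sup>2) * ennreal (l powr (real n - 2)))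
      = ennreal (l ^ (n + CARD('p) + 2))"
    using l by (simp add: ennreal_mult'[symmetric])
  have "(\<integral>\<^sup>+ z. f z * ennreal (kern n (q / l\<^sup>2) b z) \<partial>lborel) =
    ennreal (l ^ (CARD('p) + 2)) * (\<integral>\<^sup>+ z. f (l *\<^sub>R fst z, l\<^sup>2 * snd z) *
       ennreal (kern n (q / l\<^sup>2) b (l *\<^sub>R fst z, l\<^sup>2 * snd z)) \<partial>lborel)"
    using l by (subst nn_integral_lborel_parabolic_scaling[of _ l]) simp_all
  also have "(\<integral>\<^sup>+ z. f (l *\<^sub>R fst z, l\<^sup>2 * snd z) *
       ennreal (kern n (q / l\<^sup>2) b (l *\<^sub>R fst z, l\<^sup>2 * snd z)) \<partial>lborel) =
     (\<integral>\<^sup>+ z. (ennreal (l\<^sup>2) * ennreal (l powr (real n - 2))) *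
        (f z * ennreal (kern n q (l *\<^sub>R b) z)) \<partial>lborel)"
    by (intro nn_integral_cong, subst hom, rule l, subst kern_scale, rule l)
      (use l in \<open>simp add: ennreal_mult kern_nonneg ac_simps\<close>)
  also have "\<dots> = (ennreal (l\<^sup>2) * ennreal (l powr (real n - 2))) *
      (\<integral>\<^sup>+ z. f z * ennreal (kern n q (l *\<^sub>R b) z) \<partial>lborel)"
    by (rule nn_integral_cmult) simp
  also have "ennreal (l ^ (CARD('p) + 2)) * \<dots> = ennreal (l ^ (n + CARD('p) + 2)) *
      (\<integral>\<^sup>+ z. f z * ennreal (kern n q (l *\<^sub>R b) z) \<partial>lborel)"
    by (simp only: mult.assoc[symmetric] pw[symmetric])
  also have "\<dots> \<le> ennreal (l ^ (n + CARD('p) + 2)) *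
      (\<integral>\<^sup>+ z. f z * ennreal (kern n q b z) \<partial>lborel)"
    using l by (intro mult_left_mono nn_integral_even_kern_mono even) auto
  finally show ?thesis .
qed

text \<open>Differentiating the preceding inequality in \<open>l\<close> at \<open>l = 1\<close>.\<close>

lemma nn_integral_kern_second_moment_ge:
  fixes f :: "(real ^ 'p) \<times> real \<Rightarrow> ennreal"
  assumes f[measurable]: "f \<in> borel_measurable borel"
    and even: "\<And>z. f (- fst z, snd z) = f z"
    and hom: "\<And>c z. 0 < c \<Longrightarrow> f (c *\<^sub>R fst z, c\<^sup>2 * snd z) = ennreal (c\<^sup>2) * f z"
    and fin: "(\<integral>\<^sup>+ z. f z * ennreal (kern n q b z) \<partial>lborel) < \<infinity>"
    and q: "0 < q"
  shows "ennreal (real (n + CARD('p) + 2)) * (\<integral>\<^sup>+ z. f z * ennreal (kern n q b z) \<partial>lborel)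
    \<le> ennreal (2 * q) *
       (\<integral>\<^sup>+ z. f z * ennreal ((norm (fst z))\<^sup>2 + snd z) * ennreal (kern n q b z) \<partial>lborel)"
proof -
  let ?V = "\<lambda>z :: (real ^ 'p) \<times> real. (norm (fst z))\<^sup>2 + snd z"
  let ?N = "n + CARD('p) + 2"
  have V[measurable]: "?V \<in> borel_measurable borel"
    unfolding borel_prod[symmetric] by measurable
  define I where "I = (\<integral>\<^sup>+ z. f z * ennreal (kern n q b z) \<partial>lborel)"
  define J where "J = (\<integral>\<^sup>+ z. f z * ennreal (?V z) * ennreal (kern n q b z) \<partial>lborel)"
  \<comment> \<open>The kernels at \<open>q\<close> and \<open>q / l\<^sup>2\<close> are compared
    through the tangent bound 1 <= exp(-y) + y with y = q (1/l^2 - 1) V. This avoids differentiating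
    under the integral sign.\<close>
  have split: "I \<le> ennreal (l ^ ?N) * I + ennreal (q * (1 / l\<^sup>2 - 1)) * J" if l: "0 < l" "l < 1" for l
  proof -
    have l2: "l\<^sup>2 \<le> 1" using l by (simp add: power_le_one)
    have pt: "kern n q b z \<le> kern n (q / l\<^sup>2) b z + q * (1 / l\<^sup>2 - 1) * ?V z * kern n q b z" for z
    proof (cases "snd z \<le> 0")
      case False
      let ?y = "q * (1 / l\<^sup>2 - 1) * ?V z"
      have "1 \<le> exp (- ?y) + ?y" using exp_ge_add_one_self[of "- ?y"] by simp
      then have "kern n q b z * 1 \<le> kern n q b z * (exp (- ?y) + ?y)"
        by (rule mult_left_mono) (rule kern_nonneg)
      moreover have "exp (- q * ?V z) * exp (- ?y) = exp (- (q / l\<^sup>2) * ?V z)"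
        by (simp add: exp_add[symmetric] algebra_simps)
      then have "kern n q b z * exp (- ?y) = kern n (q / l\<^sup>2) b z"
        using False by (simp add: kern_def mult.assoc mult.left_commute)
      ultimately show ?thesis by (simp add: algebra_simps)
    qed (simp add: kern_def)
    have "f z * ennreal (kern n q b z) \<le> f z * ennreal (kern n (q / l\<^sup>2) b z)
        + ennreal (q * (1 / l\<^sup>2 - 1)) * (f z * ennreal (?V z) * ennreal (kern n q b z))" for z
    proof (cases "snd z \<le> 0")
      case False
      have "f z * ennreal (kern n q b z) \<le> f z * ennreal (kern n (q / l\<^sup>2) b z + q * (1 / l\<^sup>2 - 1) * ?V z * kern n q b z)"
        using pt by (intro mult_left_mono ennreal_leI) auto
      also have "\<dots> = f z * ennreal (kern n (q / l\<^sup>2) b z)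
        + ennreal (q * (1 / l\<^sup>2 - 1)) * (f z * ennreal (?V z) * ennreal (kern n q b z))"
        using False q l l2
        by (subst ennreal_plus) (simp_all add: kern_nonneg ennreal_mult distrib_left ac_simps)
      finally show ?thesis .
    qed (simp add: kern_def)
    then have "I \<le> (\<integral>\<^sup>+ z. f z * ennreal (kern n (q / l\<^sup>2) b z)
        + ennreal (q * (1 / l\<^sup>2 - 1)) * (f z * ennreal (?V z) * ennreal (kern n q b z)) \<partial>lborel)"
      unfolding I_def by (intro nn_integral_mono)
    also have "\<dots> = (\<integral>\<^sup>+ z. f z * ennreal (kern n (q / l\<^sup>2) b z) \<partial>lborel)
        + ennreal (q * (1 / l\<^sup>2 - 1)) * J"
      unfolding J_def by (simp add: nn_integral_add nn_integral_cmult)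
    also have "\<dots> \<le> ennreal (l ^ ?N) * I + ennreal (q * (1 / l\<^sup>2 - 1)) * J"
      unfolding I_def using l by (intro add_right_mono nn_integral_kern_scaling_le even hom) auto
    finally show ?thesis .
  qed
  show ?thesis
  proof (cases "J = \<infinity>")
    case True
    then show ?thesis using q by (simp add: J_def[symmetric] ennreal_mult_top)
  next
    case False
    obtain j where j: "J = ennreal j" "0 \<le> j" using False by (cases J) auto
    obtain i where i: "I = ennreal i" "0 \<le> i" using fin unfolding I_def[symmetric] by (cases I) auto
    \<comment> \<open>With \<open>I\<close> and \<open>J\<close> finite, \<open>split\<close>
      becomes an inequality between reals. After multiplication by \<open>l\<^sup>2\<close> both
      sides contain the factor \<open>1 - l\<close>, on the left through the geometric sum for
      \<open>1 - l ^ ?N\<close>, and it is cancelled.\<close>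
    have bound: "l\<^sup>2 * (\<Sum>k<?N. l ^ k) * i \<le> q * (1 + l) * j" if l: "0 < l" "l < 1" for l
    proof -
      have l2: "l\<^sup>2 \<le> 1" using l by (simp add: power_le_one)
      have "ennreal i \<le> ennreal (l ^ ?N * i + q * (1 / l\<^sup>2 - 1) * j)"
        using split[OF l] l l2 q i j by (simp add: ennreal_mult'[symmetric] ennreal_plus[symmetric] del: ennreal_plus)
      then have "i \<le> l ^ ?N * i + q * (1 / l\<^sup>2 - 1) * j"
        by (subst (asm) ennreal_le_iff) (use i j l l2 q in auto)
      then have "l\<^sup>2 * ((1 - l ^ ?N) * i) \<le> l\<^sup>2 * (q * (1 / l\<^sup>2 - 1) * j)"
        by (intro mult_left_mono) (auto simp: algebra_simps)
      also have "l\<^sup>2 * (q * (1 / l\<^sup>2 - 1) * j) = (1 - l) * (q * (1 + l) * j)"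
        using l by (simp add: field_simps power2_eq_square)
      also have "l\<^sup>2 * ((1 - l ^ ?N) * i) = (1 - l) * (l\<^sup>2 * (\<Sum>k<?N. l ^ k) * i)"
        by (simp only: one_diff_power_eq mult_ac)
      finally show ?thesis using l by simp
    qed
    \<comment> \<open>At the limit the geometric sum consists of \<open>?N\<close> ones, which is
      where the constant comes from.\<close>
    have "1\<^sup>2 * (\<Sum>k<?N. 1 ^ k) * i \<le> q * (1 + 1) * j"
    proof (rule tendsto_le[of "at_left (1::real)"])
      show "((\<lambda>l. l\<^sup>2 * (\<Sum>k<?N. l ^ k) * i) \<longlongrightarrow> 1\<^sup>2 * (\<Sum>k<?N. 1 ^ k) * i) (at_left 1)"
        by (intro tendsto_intros)
      show "((\<lambda>l. q * (1 + l) * j) \<longlongrightarrow> q * (1 + 1) * j) (at_left 1)"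
        by (intro tendsto_intros)
      show "\<forall>\<^sub>F l in at_left 1. l\<^sup>2 * (\<Sum>k<?N. l ^ k) * i \<le> q * (1 + l) * j"
        using eventually_at_left_real[OF zero_less_one] by eventually_elim (rule bound, auto)
    qed simp
    then have "real ?N * i \<le> 2 * q * j" by simp
    then have "ennreal (real ?N) * I \<le> ennreal (2 * q) * J"
      using i j q by (simp only: i j ennreal_mult'[symmetric]) (intro ennreal_leI)
    then show ?thesis by (simp add: I_def J_def)
  qed
qed

section \<open>Coordinate integrals and the normal law\<close>

text \<open>The product formula over \<open>Basis\<close> is carried over to coordinate indices by
  the bijection sending \<open>i\<close> to \<open>axis i 1\<close>.\<close>

lemma nn_integral_vec_prod:
  fixes f :: "'p::finite \<Rightarrow> real \<Rightarrow> ennreal"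
  assumes f[measurable]: "\<And>i. f i \<in> borel_measurable borel"
  shows "(\<integral>\<^sup>+ x. (\<Prod>i\<in>UNIV. f i (x $ i)) \<partial>(lborel :: (real ^ 'p) measure)) =
    (\<Prod>i\<in>UNIV. \<integral>\<^sup>+ t. f i t \<partial>lborel)"
proof -
  have bij: "bij_betw (\<lambda>i. axis i 1) UNIV (Basis :: (real ^ 'p) set)"
    by (auto simp: bij_betw_def inj_on_def axis_eq_axis Basis_vec_def)
  have "(\<Prod>i\<in>UNIV. f i (x $ i)) = (\<Prod>b\<in>Basis. f (axis_index b) (x \<bullet> b))" for x :: "real ^ 'p"
    by (subst prod.reindex_bij_betw[OF bij, symmetric]) (simp add: axis_index_axis inner_axis)
  then have "(\<integral>\<^sup>+ x. (\<Prod>i\<in>UNIV. f i (x $ i)) \<partial>(lborel :: (real ^ 'p) measure)) =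
      (\<Prod>b\<in>(Basis :: (real ^ 'p) set). \<integral>\<^sup>+ t. f (axis_index b) t \<partial>lborel)"
    by (simp only:) (rule nn_integral_lborel_prod, auto)
  also have "\<dots> = (\<Prod>i\<in>UNIV. \<integral>\<^sup>+ t. f i t \<partial>lborel)"
    by (subst prod.reindex_bij_betw[OF bij, symmetric]) (simp add: axis_index_axis)
  finally show ?thesis .
qed

lemma nn_integral_normal_density:
  assumes "0 < \<sigma>"
  shows "(\<integral>\<^sup>+ t. ennreal (normal_density m \<sigma> t) \<partial>lborel) = 1"
  using assms by (subst nn_integral_eq_integral) auto

lemma nn_integral_normal_second_moment:
  assumes "0 < \<sigma>"
  shows "(\<integral>\<^sup>+ t. ennreal ((t - m)\<^sup>2 * normal_density m \<sigma> t) \<partial>lborel) = ennreal (\<sigma>\<^sup>2)"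
proof -
  have "has_bochner_integral lborel (\<lambda>t. normal_density m \<sigma> t * (t - m)\<^sup>2) (\<sigma>\<^sup>2)"
    using normal_moment_even[OF assms, of m 1] by (simp add: fact_numeral)
  then have "(\<integral>\<^sup>+ t. ennreal (normal_density m \<sigma> t * (t - m)\<^sup>2) \<partial>lborel) = ennreal (\<sigma>\<^sup>2)"
    by (subst nn_integral_eq_integral)
      (auto simp: has_bochner_integral_iff)
  then show ?thesis by (simp add: mult.commute)
qed

lemma sets_isotropic_normal[measurable_cong]: "sets (isotropic_normal \<theta> \<sigma>) = sets borel"
  by (simp add: isotropic_normal_def)

lemma measurable_isotropic_density[measurable]:
  "(\<lambda>x :: real ^ 'p::finite. \<Prod>i\<in>UNIV. normal_density (\<theta> $ i) \<sigma> (x $ i)) \<in> borel_measurable borel"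
  by measurable

lemma prob_space_isotropic_normal:
  fixes \<theta> :: "real ^ 'p"
  assumes "0 < \<sigma>"
  shows "prob_space (isotropic_normal \<theta> \<sigma>)"
proof
  have "emeasure (isotropic_normal \<theta> \<sigma>) UNIV = (\<integral>\<^sup>+ x.
      (\<Prod>i\<in>UNIV. ennreal (normal_density (\<theta> $ i) \<sigma> (x $ i))) \<partial>(lborel :: (real ^ 'p) measure))"
    unfolding isotropic_normal_def by (subst emeasure_density) (auto simp: prod_ennreal)
  also have "\<dots> = 1"
    using assms by (subst nn_integral_vec_prod) (auto simp: nn_integral_normal_density)
  finally show "emeasure (isotropic_normal \<theta> \<sigma>) (space (isotropic_normal \<theta> \<sigma>)) = 1"
    by (simp add: isotropic_normal_def)
qed

text \<open>The squared norm is a sum over coordinates. In the i-th summand only the i-th factor of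
  the product density carries a square and integrates to the variance; every other factor integrates
  to 1.\<close>

lemma nn_integral_isotropic_normal_norm:
  fixes \<theta> :: "real ^ 'p"
  assumes \<sigma>: "0 < \<sigma>"
  shows "(\<integral>\<^sup>+ x. ennreal ((norm (x - \<theta>))\<^sup>2) \<partial>isotropic_normal \<theta> \<sigma>) = ennreal (real CARD('p) * \<sigma>\<^sup>2)"
proof -
  let ?d = "\<lambda>x :: real ^ 'p. \<Prod>i\<in>UNIV. normal_density (\<theta> $ i) \<sigma> (x $ i)"
  let ?f = "\<lambda>i j t. ennreal ((if j = i then (t - \<theta> $ j)\<^sup>2 else 1) * normal_density (\<theta> $ j) \<sigma> t)"
  have one: "(\<integral>\<^sup>+ t. ?f i j t \<partial>lborel) = (if j = i then ennreal (\<sigma>\<^sup>2) else 1)" for i j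
    using \<sigma> by (simp add: nn_integral_normal_density nn_integral_normal_second_moment)
  have eq: "?d x * (x $ i - \<theta> $ i)\<^sup>2 =
      (\<Prod>j\<in>UNIV. (if j = i then (x $ j - \<theta> $ j)\<^sup>2 else 1) * normal_density (\<theta> $ j) \<sigma> (x $ j))"
    for i and x :: "real ^ 'p"
    by (simp add: prod.distrib mult.commute)
  have "(\<integral>\<^sup>+ x. ennreal ((norm (x - \<theta>))\<^sup>2) \<partial>isotropic_normal \<theta> \<sigma>) =
      (\<integral>\<^sup>+ x. ennreal (?d x) * ennreal ((norm (x - \<theta>))\<^sup>2) \<partial>lborel)"
    unfolding isotropic_normal_def by (subst nn_integral_density) auto
  also have "\<dots> = (\<integral>\<^sup>+ x. (\<Sum>i\<in>UNIV. \<Prod>j\<in>UNIV. ?f i j (x $ j)) \<partial>lborel)"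
  proof (intro nn_integral_cong)
    fix x :: "real ^ 'p"
    have "(norm (x - \<theta>))\<^sup>2 = (\<Sum>i\<in>UNIV. (x $ i - \<theta> $ i)\<^sup>2)"
      unfolding power2_norm_eq_inner by (simp add: inner_vec_def power2_eq_square)
    then have "?d x * (norm (x - \<theta>))\<^sup>2 = (\<Sum>i\<in>UNIV. ?d x * (x $ i - \<theta> $ i)\<^sup>2)"
      by (simp add: sum_distrib_left)
    moreover have "ennreal (\<Sum>i\<in>UNIV. ?d x * (x $ i - \<theta> $ i)\<^sup>2) = (\<Sum>i\<in>UNIV. \<Prod>j\<in>UNIV. ?f i j (x $ j))"
      by (subst sum_ennreal[symmetric]) (auto simp only: eq, auto intro!: sum.cong prod_ennreal[symmetric] mult_nonneg_nonneg prod_nonneg)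
    ultimately show "ennreal (?d x) * ennreal ((norm (x - \<theta>))\<^sup>2) = (\<Sum>i\<in>UNIV. \<Prod>j\<in>UNIV. ?f i j (x $ j))"
      by (simp add: ennreal_mult[symmetric] prod_nonneg)
  qed
  also have "\<dots> = (\<Sum>i\<in>UNIV. \<integral>\<^sup>+ x. (\<Prod>j\<in>UNIV. ?f i j (x $ j)) \<partial>lborel)"
    by (rule nn_integral_sum) measurable
  also have "\<dots> = (\<Sum>i\<in>(UNIV :: 'p set). ennreal (\<sigma>\<^sup>2))"
    by (subst nn_integral_vec_prod) (simp, simp only: one prod.delta finite UNIV_I if_True)
  also have "\<dots> = ennreal (real CARD('p) * \<sigma>\<^sup>2)"
    by (simp add: ennreal_mult ennreal_of_nat_eq_real_of_nat)
  finally show ?thesis .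
qed

lemma prod_normal_density_eq:
  fixes \<theta> x :: "real ^ 'p"
  shows "(\<Prod>i\<in>UNIV. normal_density (\<theta> $ i) \<sigma> (x $ i)) =
    (1 / sqrt (2 * pi * \<sigma>\<^sup>2)) ^ CARD('p) * exp (- (norm (x - \<theta>))\<^sup>2 / (2 * \<sigma>\<^sup>2))"
proof -
  have "(norm (x - \<theta>))\<^sup>2 = (\<Sum>i\<in>UNIV. (x $ i - \<theta> $ i)\<^sup>2)"
    unfolding power2_norm_eq_inner by (simp add: inner_vec_def power2_eq_square)
  then show ?thesis
    by (simp add: normal_density_def prod.distrib exp_sum[symmetric] sum_negf sum_divide_distrib power_one_over prod_dividef)
qed

section \<open>The chi-square law and its rescaling\<close>

definition chi_square_density :: "nat \<Rightarrow> real \<Rightarrow> real" where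
  "chi_square_density n t = (if t \<le> 0 then 0
     else t powr (real n / 2 - 1) * exp (- t / 2) / (2 powr (real n / 2) * Gamma (real n / 2)))"

lemma measurable_chi_square_density[measurable]: "chi_square_density n \<in> borel_measurable borel"
  unfolding chi_square_density_def by measurable

lemma chi_square_density_nonneg: "0 < n \<Longrightarrow> 0 \<le> chi_square_density n t"
  by (simp add: chi_square_density_def)

lemma chi_square_eq: "chi_square n = density lborel (\<lambda>t. ennreal (chi_square_density n t))"
  by (simp add: chi_square_def chi_square_density_def)

lemma prob_space_chi_square:
  assumes n: "0 < n"
  shows "prob_space (chi_square n)"
proof
  \<comment> \<open>Euler's integrand for \<open>Gamma (real n / 2)\<close>. Doubling the variable
    carries the chi-square density to a multiple of it; at 0 both vanish, because
    \<open>0 powr a = 0\<close>.\<close>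
  let ?g = "\<lambda>t :: real. if t \<in> {0..} then t powr (real n / 2 - 1) / exp t else 0"
  have G: "0 < Gamma (real n / 2)" using n by simp
  have "(?g has_integral Gamma (real n / 2)) UNIV"
    unfolding has_integral_restrict_UNIV using n by (intro Gamma_integral_real) simp
  then have int: "(\<integral>\<^sup>+ t. ennreal (?g t) \<partial>lborel) = ennreal (Gamma (real n / 2))"
    by (intro nn_integral_has_integral_lborel) auto
  have "emeasure (chi_square n) UNIV = (\<integral>\<^sup>+ t. ennreal (chi_square_density n t) \<partial>lborel)"
    unfolding chi_square_eq by (subst emeasure_density) auto
  also have "\<dots> = (\<integral>\<^sup>+ t. 2 * ennreal (chi_square_density n (2 * t)) \<partial>lborel)"
    by (subst nn_integral_real_affine[of _ 2 0]) (simp_all add: nn_integral_cmult)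
  also have "\<dots> = (\<integral>\<^sup>+ t. ennreal (1 / Gamma (real n / 2)) * ennreal (?g t) \<partial>lborel)"
  proof (intro nn_integral_cong)
    fix t :: real
    have "2 powr (real n / 2) = 2 * 2 powr (real n / 2 - 1)" by (simp add: powr_diff)
    then have "2 * chi_square_density n (2 * t) = 1 / Gamma (real n / 2) * ?g t"
      by (auto simp: chi_square_density_def powr_mult exp_minus field_simps)
    then show "2 * ennreal (chi_square_density n (2 * t)) = ennreal (1 / Gamma (real n / 2)) * ennreal (?g t)"
      using G by (simp only: ennreal_mult'[symmetric] less_imp_le divide_nonneg_pos zero_le_one
          ennreal_numeral[symmetric] zero_le_numeral)
  qed
  also have "\<dots> = 1"
    using G by (subst nn_integral_cmult) (simp_all only: int, auto simp: ennreal_mult'[symmetric])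
  finally show "emeasure (chi_square n) (space (chi_square n)) = 1"
    by (simp add: chi_square_def)
qed

text \<open>With the second factor in this form, the product law can be written as a single Lebesgue
  density.\<close>

lemma distr_chi_square_scale:
  assumes "c > 0" "0 < n"
  shows "distr (chi_square n) borel (\<lambda>t. c * t) =
    density lborel (\<lambda>s. ennreal (chi_square_density n (s / c) / c))"
proof (rule measure_eqI)
  fix A assume "A \<in> sets (distr (chi_square n) borel (\<lambda>t. c * t))"
  then have A[measurable]: "A \<in> sets borel" by simp
  have "emeasure (distr (chi_square n) borel (\<lambda>t. c * t)) A =
     (\<integral>\<^sup>+ t. indicator A t \<partial>distr (chi_square n) borel (\<lambda>t. c * t))"
    by simp
  also have "\<dots> = (\<integral>\<^sup>+ t. ennreal (chi_square_density n t) * indicator A (c * t) \<partial>lborel)"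
    by (subst nn_integral_distr) (auto simp: chi_square_eq nn_integral_density)
  also have "\<dots> = (\<integral>\<^sup>+ t. ennreal c * (ennreal (chi_square_density n t / c) * indicator A (c * t)) \<partial>lborel)"
    using assms by (simp add: mult.assoc[symmetric] ennreal_mult[symmetric] chi_square_density_nonneg)
  also have "\<dots> = (\<integral>\<^sup>+ s. ennreal (chi_square_density n (s / c) / c) * indicator A s \<partial>lborel)"
    using assms by (subst (2) nn_integral_real_affine[of _ c 0]) (simp_all add: nn_integral_cmult)
  also have "\<dots> = emeasure (density lborel (\<lambda>s. ennreal (chi_square_density n (s / c) / c))) A"
    by (simp add: emeasure_density)
  finally show "emeasure (distr (chi_square n) borel (\<lambda>t. c * t)) A =
    emeasure (density lborel (\<lambda>s. ennreal (chi_square_density n (s / c) / c))) A" .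
qed simp

lemma prob_space_scaled_chi_square:
  "0 < n \<Longrightarrow> prob_space (distr (chi_square n) borel (\<lambda>t. c * t))"
  by (intro prob_space.prob_space_distr prob_space_chi_square) (simp_all add: chi_square_def)

section \<open>The joint law of the observation\<close>

lemma prob_space_model:
  assumes "0 < \<sigma>" "0 < n"
  shows "prob_space (model n \<theta> \<sigma>)"
proof -
  interpret A: prob_space "isotropic_normal \<theta> \<sigma>" using assms by (intro prob_space_isotropic_normal)
  interpret B: prob_space "distr (chi_square n) borel (\<lambda>t. \<sigma>\<^sup>2 * t)"
    using assms by (intro prob_space_scaled_chi_square)
  interpret pair_prob_space "isotropic_normal \<theta> \<sigma>" "distr (chi_square n) borel (\<lambda>t. \<sigma>\<^sup>2 * t)" ..
  show ?thesis unfolding model_def by unfold_locales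
qed

text \<open>Expanding the square in the normal density leaves the inner product with
  \<open>\<theta>\<close> as the only term depending on both \<open>x\<close> and
  \<open>\<theta>\<close>; this becomes the second exponential of \<open>kern\<close>. Everything
  free of \<open>x\<close> and \<open>s\<close> goes into \<open>K\<close>, of which later arguments
  use only the positivity.\<close>

lemma model_eq_density_kern:
  fixes \<theta> :: "real ^ 'p"
  assumes \<sigma>: "0 < \<sigma>" and n: "0 < n"
  obtains K where "0 < K" "model n \<theta> \<sigma> =
    density lborel (\<lambda>z. ennreal (K * kern n (1 / (2 * \<sigma>\<^sup>2)) (\<theta> /\<^sub>R \<sigma>\<^sup>2) z))"
proof
  \<comment> \<open>The factors are the Gaussian normalization, the part of the expanded square that
    depends on \<open>\<theta>\<close> alone, and the chi-square normalization after rescaling, with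
    Jacobian \<open>1 / \<sigma>\<^sup>2\<close>.\<close>
  define K where "K = (1 / sqrt (2 * pi * \<sigma>\<^sup>2)) ^ CARD('p) * exp (- (norm \<theta>)\<^sup>2 / (2 * \<sigma>\<^sup>2)) *
    ((1 / \<sigma>\<^sup>2) powr (real n / 2 - 1) / \<sigma>\<^sup>2 / (2 powr (real n / 2) * Gamma (real n / 2)))"
  show "0 < K" unfolding K_def using \<sigma> n by simp
  have pt: "(\<Prod>i\<in>UNIV. normal_density (\<theta> $ i) \<sigma> (x $ i)) * (chi_square_density n (s / \<sigma>\<^sup>2) / \<sigma>\<^sup>2)
      = K * kern n (1 / (2 * \<sigma>\<^sup>2)) (\<theta> /\<^sub>R \<sigma>\<^sup>2) (x, s)" for x s
  proof (cases "s \<le> 0")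
    case True
    then show ?thesis
      using \<sigma> by (simp add: kern_def chi_square_density_def divide_le_0_iff)
  next
    case False
    have e: "exp (- (norm (x - \<theta>))\<^sup>2 / (2 * \<sigma>\<^sup>2)) * exp (- (s / \<sigma>\<^sup>2) / 2) =
      exp (- (norm \<theta>)\<^sup>2 / (2 * \<sigma>\<^sup>2)) *
       (exp (- (1 / (2 * \<sigma>\<^sup>2)) * ((norm x)\<^sup>2 + s)) * exp ((\<theta> /\<^sub>R \<sigma>\<^sup>2) \<bullet> x))"
      unfolding exp_add[symmetric] power2_norm_eq_inner
      using \<sigma> by (simp add: inner_diff inner_commute field_simps)
    have "(s / \<sigma>\<^sup>2) powr (real n / 2 - 1) = s powr (real n / 2 - 1) * (1 / \<sigma>\<^sup>2) powr (real n / 2 - 1)"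
      using False by (subst powr_mult[symmetric]) auto
    moreover have "\<not> s / \<sigma>\<^sup>2 \<le> 0" using False \<sigma> by (simp add: divide_le_0_iff)
    \<comment> \<open>The regrouping of factors is stated for arbitrary reals, so that exponentials
      and powers stay opaque.\<close>
    moreover have "C * X * (P * S / D / v) = C * T * (s2 / v / D) * (s1 * Q * B)"
      if "X * S = T * (Q * B)" "P = s1 * s2" for C X P S D v T s1 s2 Q B :: real
    proof -
      have "C * X * (P * S / D / v) = C * (X * S) * P / D / v" by simp
      also have "\<dots> = C * T * (s2 / v / D) * (s1 * Q * B)" by (subst that(1), subst that(2)) (simp add: mult_ac)
      finally show ?thesis .
    qed
    ultimately show ?thesis
      using False e
      unfolding prod_normal_density_eq kern_def chi_square_density_def K_def fst_conv snd_conv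
      by presburger
  qed
  let ?f = "\<lambda>x. ennreal (\<Prod>i\<in>UNIV. normal_density (\<theta> $ i) \<sigma> (x $ i))"
  let ?g = "\<lambda>s. ennreal (chi_square_density n (s / \<sigma>\<^sup>2) / \<sigma>\<^sup>2)"
  have eq: "distr (chi_square n) borel (\<lambda>t. \<sigma>\<^sup>2 * t) = density lborel ?g"
    using \<sigma> n by (intro distr_chi_square_scale) auto
  have "prob_space (density lborel ?g)"
    unfolding eq[symmetric] using n by (rule prob_space_scaled_chi_square)
  then have sf: "sigma_finite_measure (density lborel ?g)"
    by (rule prob_space_imp_sigma_finite)
  have "model n \<theta> \<sigma> = density (lborel \<Otimes>\<^sub>M lborel) (\<lambda>(x, s). ?f x * ?g s)"
    unfolding model_def isotropic_normal_def eq
    by (intro pair_measure_density sf sigma_finite_lborel) auto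
  also have "(\<lambda>(x, s). ?f x * ?g s) = (\<lambda>z. ennreal (K * kern n (1 / (2 * \<sigma>\<^sup>2)) (\<theta> /\<^sub>R \<sigma>\<^sup>2) z))"
    using n by (auto simp: fun_eq_iff simp del: times_divide_eq_right
      simp flip: pt ennreal_mult intro!: ennreal_mult[symmetric] prod_nonneg chi_square_density_nonneg divide_nonneg_nonneg)
  finally show "model n \<theta> \<sigma> =
    density lborel (\<lambda>z. ennreal (K * kern n (1 / (2 * \<sigma>\<^sup>2)) (\<theta> /\<^sub>R \<sigma>\<^sup>2) z))"
    unfolding lborel_prod .
qed

text \<open>The kernel vanishes for nonpositive \<open>snd z\<close>, and the origin is Lebesgue
  null. Off the exceptional set \<open>W_stat z\<close> is positive, so the estimators are evaluated
  where \<open>\<phi>\<close> is known to be smooth.\<close>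

lemma AE_model_generic:
  fixes \<theta> :: "real ^ 'p"
  assumes \<sigma>: "0 < \<sigma>" and n: "0 < n"
  shows "AE z in model n \<theta> \<sigma>. fst z \<noteq> 0 \<and> 0 < snd z"
proof -
  obtain K where K: "0 < K" "model n \<theta> \<sigma> =
    density lborel (\<lambda>z. ennreal (K * kern n (1 / (2 * \<sigma>\<^sup>2)) (\<theta> /\<^sub>R \<sigma>\<^sup>2) z))"
    using model_eq_density_kern[OF \<sigma> n] .
  have "AE z in (lborel :: (real ^ 'p) measure) \<Otimes>\<^sub>M (lborel :: real measure). fst z \<noteq> 0"
  proof (rule lborel_pair.AE_pair_measure)
    show "AE x in (lborel :: (real ^ 'p) measure). AE s in (lborel :: real measure). fst (x, s) \<noteq> 0"
      using AE_lborel_singleton[of "0 :: real ^ 'p"] by auto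
  qed measurable
  then have "AE z in (lborel :: ((real ^ 'p) \<times> real) measure). fst z \<noteq> 0"
    unfolding lborel_prod .
  then show ?thesis
    unfolding K(2)
    by (subst AE_density) (simp, auto elim!: eventually_mono simp: kern_def not_le split: if_splits)
qed

lemma nn_integral_model_fst_error:
  fixes \<theta> :: "real ^ 'p"
  assumes \<sigma>: "0 < \<sigma>" and n: "0 < n"
  shows "(\<integral>\<^sup>+ z. ennreal ((norm (fst z - \<theta>))\<^sup>2) \<partial>model n \<theta> \<sigma>) = ennreal (real CARD('p) * \<sigma>\<^sup>2)"
proof -
  interpret B: prob_space "distr (chi_square n) borel (\<lambda>t. \<sigma>\<^sup>2 * t)"
    using n by (intro prob_space_scaled_chi_square)
  have "(\<integral>\<^sup>+ z. ennreal ((norm (fst z - \<theta>))\<^sup>2) \<partial>model n \<theta> \<sigma>) =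
    (\<integral>\<^sup>+ x. \<integral>\<^sup>+ s. ennreal ((norm (x - \<theta>))\<^sup>2) \<partial>distr (chi_square n) borel (\<lambda>t. \<sigma>\<^sup>2 * t) \<partial>isotropic_normal \<theta> \<sigma>)"
    unfolding model_def by (subst B.nn_integral_fst[symmetric]) simp_all
  also have "\<dots> = ennreal (real CARD('p) * \<sigma>\<^sup>2)"
    using nn_integral_isotropic_normal_norm[OF \<sigma>, of \<theta>] B.emeasure_space_1 by simp
  finally show ?thesis .
qed

section \<open>Tail integrals and continuity of \<open>g_fun\<close>\<close>

text \<open>Convergence may be only conditional, so passing to the shorter half-line is done by
  subtracting the integral over the compact piece.\<close>

lemma integrable_on_atLeast_iff:
  fixes f :: "real \<Rightarrow> real"
  assumes f: "f integrable_on {c..d}" and "c \<le> d"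
  shows "f integrable_on {c..} \<longleftrightarrow> f integrable_on {d..}"
    and "f integrable_on {c..} \<Longrightarrow> integral {d..} f = integral {c..} f - integral {c..d} f"
proof -
  have un: "{c..d} \<union> {d..} = {c..}" and int: "{c..d} \<inter> {d..} = {d}" using \<open>c \<le> d\<close> by auto
  have fw: "(f has_integral (I - integral {c..d} f)) {d..}" if I: "(f has_integral I) {c..}" for I
  proof -
    have "((\<lambda>x. (if x \<in> {c..} then f x else 0) - (if x \<in> {c..d} then f x else 0)) has_integral
        (I - integral {c..d} f)) UNIV"
      using I f by (intro has_integral_diff)
        (simp_all only: has_integral_restrict_UNIV integrable_integral)
    \<comment> \<open>The difference of the two restrictions is 0 at \<open>d\<close>, where
      \<open>f d\<close> is wanted; a single point is negligible.\<close>
    then have "((\<lambda>x. if x \<in> {d..} then f x else 0) has_integral (I - integral {c..d} f)) UNIV"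
      by (rule has_integral_spike[of "{d}", rotated 2]) (use \<open>c \<le> d\<close> in auto)
    then show ?thesis by (simp only: has_integral_restrict_UNIV)
  qed
  show "f integrable_on {c..} \<longleftrightarrow> f integrable_on {d..}"
    using integrable_Un[of "{c..d}" "{d..}" f] f un int fw by (auto simp: integrable_on_def)
  show "integral {d..} f = integral {c..} f - integral {c..d} f" if "f integrable_on {c..}"
    by (rule integral_unique, rule fw) (rule integrable_integral[OF that])
qed

text \<open>If the integral diverges, it does so for every lower limit, and \<open>integral\<close> returns 0
  throughout.\<close>

lemma continuous_on_integral_atLeast:
  fixes f :: "real \<Rightarrow> real"
  assumes f: "continuous_on {0<..} f"
  shows "continuous_on {0<..} (\<lambda>w. integral {w..} f)"
proof -
  have int: "f integrable_on {c..d}" if "0 < c" for c d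
    by (intro integrable_continuous_real continuous_on_subset[OF f]) (use that in auto)
  have iff: "f integrable_on {c..} \<longleftrightarrow> f integrable_on {1..}" if "0 < c" for c
    using integrable_on_atLeast_iff(1)[of f c 1] integrable_on_atLeast_iff(1)[of f 1 c] int that
    by (cases "c \<le> 1") auto
  show ?thesis
  proof (cases "f integrable_on {1..}")
    case False
    then have "integral {w..} f = 0" if "w \<in> {0<..}" for w
      using iff[of w] that by (blast intro: not_integrable_integral)
    then show ?thesis by (subst continuous_on_cong[OF refl, where g = "\<lambda>_. 0"]) auto
  next
    case True
    show ?thesis
      unfolding continuous_on_eq_continuous_at[OF open_greaterThan]
    proof
      fix w :: real assume w: "w \<in> {0<..}"
      \<comment> \<open>On a neighbourhood of \<open>w\<close> the tail integral is a constant minus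
        an indefinite integral based at \<open>?c\<close>, which is still positive.\<close>
      let ?c = "w / 2"
      have "continuous_on {?c..2 * w} (\<lambda>u. integral {?c..} f - integral {?c..u} f)"
        using w by (intro continuous_intros indefinite_integral_continuous_1 int) auto
      moreover have "integral {u..} f = integral {?c..} f - integral {?c..u} f" if "u \<in> {?c..2 * w}" for u
        using w that iff[of ?c] True by (intro integrable_on_atLeast_iff(2) int) simp_all
      ultimately have "continuous_on {?c..2 * w} (\<lambda>u. integral {u..} f)"
        by (simp only: cong: continuous_on_cong)
      then have "continuous_on {?c<..<2 * w} (\<lambda>u. integral {u..} f)"
        by (rule continuous_on_subset) auto
      then show "isCont (\<lambda>w. integral {w..} f) w"
        using w by (subst (asm) continuous_on_eq_continuous_at) auto
    qed
  qed
qed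

text \<open>This continuity serves to make the estimators Borel measurable functions of
  \<open>W_stat\<close>.\<close>

lemma continuous_on_g_fun:
  assumes diff: "\<And>w. w > 0 \<Longrightarrow> \<phi> differentiable (at w)"
    and cont: "continuous_on {0<..} (deriv \<phi>)"
  shows "continuous_on {0<..} (g_fun n p \<phi>)"
proof -
  have \<phi>: "continuous_on {0<..} \<phi>"
    using diff by (intro differentiable_imp_continuous_on)
      (auto simp: differentiable_on_def intro: differentiable_at_withinI)
  show ?thesis
    unfolding g_fun_def h_fun_def
    by (intro continuous_intros continuous_on_integral_atLeast \<phi> cont) auto
qed

section \<open>Invariance of \<open>W_stat\<close> and truncation from above\<close>

lemma measurable_W_stat[measurable]: "W_stat \<in> borel_measurable borel"
  unfolding W_stat_def borel_prod[symmetric] by measurable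

lemma W_stat_reflect: "W_stat (- fst z, snd z) = W_stat z"
  by (simp add: W_stat_def)

lemma W_stat_scale: "c \<noteq> 0 \<Longrightarrow> W_stat (c *\<^sub>R fst z, c\<^sup>2 * snd z) = W_stat z"
  by (simp add: W_stat_def power_mult_distrib)

text \<open>This is the kernel inequality at \<open>q = 1 / (2 * \<sigma>\<^sup>2)\<close>,
  multiplied by the variance and by the normalizing constant of the density.\<close>

lemma nn_integral_model_second_moment_ge:
  fixes f :: "(real ^ 'p) \<times> real \<Rightarrow> ennreal"
  assumes \<sigma>: "0 < \<sigma>" and n: "0 < n"
    and f[measurable]: "f \<in> borel_measurable borel"
    and even: "\<And>z. f (- fst z, snd z) = f z"
    and hom: "\<And>c z. 0 < c \<Longrightarrow> f (c *\<^sub>R fst z, c\<^sup>2 * snd z) = ennreal (c\<^sup>2) * f z"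
    and fin: "(\<integral>\<^sup>+ z. f z \<partial>model n \<theta> \<sigma>) < \<infinity>"
  shows "ennreal (real (n + CARD('p) + 2) * \<sigma>\<^sup>2) * (\<integral>\<^sup>+ z. f z \<partial>model n \<theta> \<sigma>)
    \<le> (\<integral>\<^sup>+ z. f z * ennreal ((norm (fst z))\<^sup>2 + snd z) \<partial>model n \<theta> \<sigma>)"
proof -
  let ?q = "1 / (2 * \<sigma>\<^sup>2)" and ?b = "\<theta> /\<^sub>R \<sigma>\<^sup>2" and ?N = "real (n + CARD('p) + 2)"
  let ?V = "\<lambda>z :: (real ^ 'p) \<times> real. (norm (fst z))\<^sup>2 + snd z"
  have V[measurable]: "?V \<in> borel_measurable borel"
    unfolding borel_prod[symmetric] by measurable
  obtain K where K: "0 < K" "model n \<theta> \<sigma> = density lborel (\<lambda>z. ennreal (K * kern n ?q ?b z))"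
    using model_eq_density_kern[OF \<sigma> n] .
  have int: "(\<integral>\<^sup>+ z. F z \<partial>model n \<theta> \<sigma>) = ennreal K * (\<integral>\<^sup>+ z. F z * ennreal (kern n ?q ?b z) \<partial>lborel)"
    if [measurable]: "F \<in> borel_measurable borel" for F
    unfolding K(2) using K(1)
    by (subst nn_integral_density)
      (simp_all add: ennreal_mult kern_nonneg nn_integral_cmult[symmetric] mult_ac)
  let ?I = "\<integral>\<^sup>+ z. f z * ennreal (kern n ?q ?b z) \<partial>lborel"
  let ?J = "\<integral>\<^sup>+ z. f z * ennreal (?V z) * ennreal (kern n ?q ?b z) \<partial>lborel"
  have fin': "?I < \<infinity>"
    using fin K(1) unfolding int[OF f] by (auto simp: ennreal_mult_less_top)
  have "ennreal ?N * ?I \<le> ennreal (2 * ?q) * ?J"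
    using \<sigma> by (intro nn_integral_kern_second_moment_ge f even hom fin') auto
  then have "ennreal (K * \<sigma>\<^sup>2) * (ennreal ?N * ?I) \<le> ennreal (K * \<sigma>\<^sup>2) * (ennreal (2 * ?q) * ?J)"
    by (rule mult_left_mono) simp
  also have "\<dots> = ennreal K * ?J"
    using \<sigma> K(1) by (simp add: mult.assoc[symmetric] ennreal_mult'[symmetric])
  also have "ennreal (K * \<sigma>\<^sup>2) * (ennreal ?N * ?I) = ennreal (?N * \<sigma>\<^sup>2) * (ennreal K * ?I)"
  proof -
    have "ennreal (K * \<sigma>\<^sup>2) * ennreal ?N = ennreal (?N * \<sigma>\<^sup>2) * ennreal K"
      using K(1) by (subst (1 2) ennreal_mult[symmetric]) (simp_all add: mult_ac)
    then show ?thesis by (simp only: mult.assoc[symmetric])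
  qed
  finally show ?thesis by (subst (1 2) int) simp_all
qed

text \<open>For \<open>u > c\<close> the right side exceeds the left by exactly
  \<open>(V * (u - c))\<^sup>2\<close>; otherwise the two sides coincide.\<close>

lemma truncation_pointwise:
  fixes R V c u :: real
  assumes "0 \<le> V" "0 \<le> c" "0 \<le> u"
  shows "(V * min u c - R)\<^sup>2 + 2 * c * (max 0 (u - c) * V * V) \<le> (V * u - R)\<^sup>2 + 2 * R * (max 0 (u - c) * V)"
proof (cases "u \<le> c")
  case False
  have "(V * u - R)\<^sup>2 + 2 * R * ((u - c) * V) - ((V * c - R)\<^sup>2 + 2 * c * ((u - c) * V * V)) = (V * (u - c))\<^sup>2"
    by (simp add: power2_eq_square algebra_simps)
  with False show ?thesis by (smt (verit) zero_le_power2)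
qed simp

text \<open>The level \<open>c\<close> is chosen so that \<open>2 * c\<close> times the constant of
  the moment inequality is \<open>2 * (real CARD('p) * \<sigma>\<^sup>2)\<close>, which dominates
  \<open>2 * R\<close>. Integrating the pointwise inequality then gives the claim.\<close>

lemma nn_integral_truncation_le:
  fixes \<theta> :: "real ^ 'p" and u :: "real \<Rightarrow> real" and n :: nat
  defines "V \<equiv> \<lambda>z :: (real ^ 'p) \<times> real. (norm (fst z))\<^sup>2 + snd z"
    and "c \<equiv> real CARD('p) / real (n + CARD('p) + 2)"
  assumes \<sigma>: "0 < \<sigma>" and n: "0 < n"
    and R: "0 \<le> R" "R \<le> real CARD('p) * \<sigma>\<^sup>2"
    and u[measurable]: "u \<in> borel_measurable borel" and u0: "\<And>w. 0 \<le> u w"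
  shows "(\<integral>\<^sup>+ z. ennreal ((V z * min (u (W_stat z)) c - R)\<^sup>2) \<partial>model n \<theta> \<sigma>)
    \<le> (\<integral>\<^sup>+ z. ennreal ((V z * u (W_stat z) - R)\<^sup>2) \<partial>model n \<theta> \<sigma>)"
proof (cases "(\<integral>\<^sup>+ z. ennreal ((V z * u (W_stat z) - R)\<^sup>2) \<partial>model n \<theta> \<sigma>) = \<infinity>")
  case fin: False
  let ?\<mu> = "model n \<theta> \<sigma>"
  interpret prob_space ?\<mu> using \<sigma> n by (rule prob_space_model)
  have V[measurable]: "V \<in> borel_measurable borel"
    unfolding V_def borel_prod[symmetric] by measurable
  have sets_model[measurable_cong]: "sets ?\<mu> = sets borel"
    by (rule model_eq_density_kern[OF \<sigma> n, of \<theta>]) simp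
  have c: "0 \<le> c" by (simp add: c_def)
  \<comment> \<open>The amount removed by the truncation. It is even and homogeneous of degree 2, as
    the moment inequality requires.\<close>
  define D where "D = (\<lambda>z. max 0 (u (W_stat z) - c) * V z)"
  have D[measurable]: "D \<in> borel_measurable borel" unfolding D_def by measurable
  have pos: "AE z in ?\<mu>. 0 \<le> V z"
    using AE_model_generic[OF \<sigma> n, of \<theta>] by eventually_elim (simp add: V_def)
  have D0: "0 \<le> D z" if "0 \<le> V z" for z using that by (simp add: D_def)
  have "(\<integral>\<^sup>+ z. ennreal (D z) \<partial>?\<mu>) \<le>
      (\<integral>\<^sup>+ z. ennreal ((V z * u (W_stat z) - R)\<^sup>2) + ennreal (R + 1) \<partial>?\<mu>)"
    using pos
  proof (intro nn_integral_mono_AE, eventually_elim)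
    fix z assume "0 \<le> V z"
    then have "D z \<le> V z * u (W_stat z)"
      using c u0[of "W_stat z"] by (auto simp: D_def max_def mult.commute intro: mult_left_mono)
    \<comment> \<open>Finite risk thus forces a finite mean of \<open>D\<close>, from y <= y^2 + 1/4
      with y = V u - R.\<close>
    also have "\<dots> \<le> (V z * u (W_stat z) - R)\<^sup>2 + (R + 1)"
      using zero_le_power2[of "V z * u (W_stat z) - R - 1 / 2"]
      by (simp add: power2_eq_square algebra_simps)
    finally show "ennreal (D z) \<le> ennreal ((V z * u (W_stat z) - R)\<^sup>2) + ennreal (R + 1)"
      using R by (simp add: ennreal_plus[symmetric] ennreal_leI del: ennreal_plus)
  qed
  also have "\<dots> = (\<integral>\<^sup>+ z. ennreal ((V z * u (W_stat z) - R)\<^sup>2) \<partial>?\<mu>) + ennreal (R + 1)"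
    by (subst nn_integral_add) (auto simp: emeasure_space_1)
  also have "\<dots> < \<infinity>" using fin by (simp add: less_top)
  finally have finD: "(\<integral>\<^sup>+ z. ennreal (D z) \<partial>?\<mu>) < \<infinity>" .
  have "ennreal (real (n + CARD('p) + 2) * \<sigma>\<^sup>2) * (\<integral>\<^sup>+ z. ennreal (D z) \<partial>?\<mu>)
      \<le> (\<integral>\<^sup>+ z. ennreal (D z) * ennreal (V z) \<partial>?\<mu>)"
    unfolding V_def
  proof (rule nn_integral_model_second_moment_ge[OF \<sigma> n])
    show "ennreal (D (- fst z, snd z)) = ennreal (D z)" for z
      by (simp add: D_def V_def W_stat_reflect)
  next
    fix a :: real and z :: "(real ^ 'p) \<times> real" assume a: "0 < a"
    have "D (a *\<^sub>R fst z, a\<^sup>2 * snd z) = a\<^sup>2 * D z"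
      using a unfolding D_def V_def by (subst W_stat_scale) (simp_all add: power_mult_distrib algebra_simps)
    then show "ennreal (D (a *\<^sub>R fst z, a\<^sup>2 * snd z)) = ennreal (a\<^sup>2) * ennreal (D z)"
      by (simp add: ennreal_mult')
  qed (use finD in simp_all)
  then have "ennreal (2 * c) * (ennreal (real (n + CARD('p) + 2) * \<sigma>\<^sup>2) * (\<integral>\<^sup>+ z. ennreal (D z) \<partial>?\<mu>))
      \<le> ennreal (2 * c) * (\<integral>\<^sup>+ z. ennreal (D z) * ennreal (V z) \<partial>?\<mu>)"
    by (rule mult_left_mono) simp
  also have "ennreal (2 * c) * (ennreal (real (n + CARD('p) + 2) * \<sigma>\<^sup>2) * (\<integral>\<^sup>+ z. ennreal (D z) \<partial>?\<mu>))
      = ennreal (2 * (real CARD('p) * \<sigma>\<^sup>2)) * (\<integral>\<^sup>+ z. ennreal (D z) \<partial>?\<mu>)"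
  proof -
    have "2 * c * (real (n + CARD('p) + 2) * \<sigma>\<^sup>2) = 2 * (real CARD('p) * \<sigma>\<^sup>2)"
      by (simp add: c_def field_simps)
    then show ?thesis using c by (simp only: mult.assoc[symmetric] ennreal_mult'[symmetric] mult_nonneg_nonneg zero_le_numeral)
  qed
  finally have VD: "ennreal (2 * (real CARD('p) * \<sigma>\<^sup>2)) * (\<integral>\<^sup>+ z. ennreal (D z) \<partial>?\<mu>)
      \<le> ennreal (2 * c) * (\<integral>\<^sup>+ z. ennreal (D z) * ennreal (V z) \<partial>?\<mu>)" .
  let ?L = "\<integral>\<^sup>+ z. ennreal ((V z * min (u (W_stat z)) c - R)\<^sup>2) \<partial>?\<mu>"
  \<comment> \<open>Subtraction of extended nonnegative values is avoided: the mean of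
    \<open>D\<close> is added to both risks and cancelled at the end, being finite.\<close>
  have "?L + ennreal (2 * R) * (\<integral>\<^sup>+ z. ennreal (D z) \<partial>?\<mu>) \<le>
      ?L + ennreal (2 * c) * (\<integral>\<^sup>+ z. ennreal (D z) * ennreal (V z) \<partial>?\<mu>)"
    using R by (intro add_left_mono order_trans[OF _ VD] mult_right_mono ennreal_leI) auto
  also have "\<dots> = (\<integral>\<^sup>+ z. ennreal ((V z * min (u (W_stat z)) c - R)\<^sup>2) +
      ennreal (2 * c) * (ennreal (D z) * ennreal (V z)) \<partial>?\<mu>)"
    by (simp add: nn_integral_add nn_integral_cmult)
  also have "\<dots> \<le> (\<integral>\<^sup>+ z. ennreal ((V z * u (W_stat z) - R)\<^sup>2) + ennreal (2 * R) * ennreal (D z) \<partial>?\<mu>)"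
    using pos
  proof (intro nn_integral_mono_AE, eventually_elim)
    fix z assume z: "0 \<le> V z"
    have "(V z * min (u (W_stat z)) c - R)\<^sup>2 + 2 * c * (D z * V z) \<le> (V z * u (W_stat z) - R)\<^sup>2 + 2 * R * D z"
      unfolding D_def using truncation_pointwise[OF z c u0] .
    then show "ennreal ((V z * min (u (W_stat z)) c - R)\<^sup>2) + ennreal (2 * c) * (ennreal (D z) * ennreal (V z))
      \<le> ennreal ((V z * u (W_stat z) - R)\<^sup>2) + ennreal (2 * R) * ennreal (D z)"
      using c R z D0[OF z]
      by (simp add: ennreal_mult[symmetric] ennreal_plus[symmetric] ennreal_leI del: ennreal_plus)
  qed
  also have "\<dots> = (\<integral>\<^sup>+ z. ennreal ((V z * u (W_stat z) - R)\<^sup>2) \<partial>?\<mu>) + ennreal (2 * R) * (\<integral>\<^sup>+ z. ennreal (D z) \<partial>?\<mu>)"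
    by (simp add: nn_integral_add nn_integral_cmult)
  finally have "ennreal (2 * R) * (\<integral>\<^sup>+ z. ennreal (D z) \<partial>?\<mu>) + ?L
      \<le> ennreal (2 * R) * (\<integral>\<^sup>+ z. ennreal (D z) \<partial>?\<mu>)
        + (\<integral>\<^sup>+ z. ennreal ((V z * u (W_stat z) - R)\<^sup>2) \<partial>?\<mu>)"
    by (simp only: add.commute)
  then show ?thesis
    using finD by (simp only: ennreal_add_left_cancel_le) (auto simp: ennreal_mult_eq_top_iff)
qed simp

section \<open>Bound on the mean squared error and comparison of its estimators\<close>

text \<open>The risk of \<open>fst\<close> is finite, hence so is that of the shrinkage estimator,
  and \<open>enn2real\<close> preserves the comparison.\<close>

lemma mse_le:
  fixes \<theta> :: "real ^ 'p"
  assumes "improves_on (model n) squared_error (shrink \<phi> :: (real ^ 'p) \<times> real \<Rightarrow> real ^ 'p) fst"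
    and "0 < \<sigma>" "0 < n"
  shows "mse n \<phi> \<theta> \<sigma> \<le> real CARD('p) * \<sigma>\<^sup>2"
proof -
  have "risk (model n \<theta> \<sigma>) (\<lambda>z. squared_error \<theta> \<sigma> (shrink \<phi> z)) \<le> ennreal (real CARD('p) * \<sigma>\<^sup>2)"
    using assms nn_integral_model_fst_error[of \<sigma> n \<theta>]
    unfolding improves_on_def risk_def squared_error_def by metis
  then have "mse n \<phi> \<theta> \<sigma> \<le> enn2real (ennreal (real CARD('p) * \<sigma>\<^sup>2))"
    unfolding mse_def by (intro enn2real_mono) auto
  then show ?thesis by simp
qed

lemma R0_hat_eq:
  fixes z :: "(real ^ 'p) \<times> real"
  assumes "0 < n"
  shows "R0_hat n \<phi> z = real CARD('p) * snd z / real n * (1 - a_fun n CARD('p) \<phi> (W_stat z))"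
  using assms by (simp add: R0_hat_def a_fun_def field_simps)

text \<open>Multiplying \<open>psi0\<close> by the positive value of \<open>a_fun\<close> clears its
  reciprocals and keeps the order of max and min; subtracting the result from 1 then exchanges the
  two.\<close>

lemma R_hat_psi0_eq:
  fixes z :: "(real ^ 'p) \<times> real"
  assumes n: "0 < n" and z: "snd z > 0" and a: "a_fun n CARD('p) \<phi> (W_stat z) > 0"
  shows "R_hat n \<phi> (psi0 n CARD('p) \<phi>) z = R0_trunc n \<phi> z"
proof -
  let ?a = "a_fun n CARD('p) \<phi> (W_stat z)" and ?k = "real CARD('p) * snd z / real n"
  let ?t = "real n * (1 + W_stat z) / (real n + real CARD('p) + 2)"
  have k: "0 < ?k" using n z by simp
  have "?a * psi0 n CARD('p) \<phi> (W_stat z) = max (min ?a 1) (1 - ?t)"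
    using a unfolding psi0_def by (simp add: max_mult_distrib_left min_mult_distrib_left)
  then have "1 - ?a * psi0 n CARD('p) \<phi> (W_stat z) = min (max (1 - ?a) 0) ?t"
    by (simp add: min_def max_def)
  then have "R_hat n \<phi> (psi0 n CARD('p) \<phi>) z = min (max (?k * (1 - ?a)) (?k * 0)) (?k * ?t)"
    using k unfolding R_hat_def by (simp only: min_mult_distrib_left max_mult_distrib_left less_imp_le if_True)
  also have "?k * ?t = real CARD('p) * snd z * (1 + W_stat z) / (real n + real CARD('p) + 2)"
    using n by simp
  finally show ?thesis unfolding R0_trunc_def R0_hat_eq[OF n] by simp
qed

text \<open>The two clippings are compared in turn: the positive part against \<open>R0_hat\<close>
  pointwise, then the cap against the positive part in the mean.\<close>

lemma R0_trunc_improves: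
  fixes \<phi> :: "real \<Rightarrow> real" and n :: nat
  assumes n: "n > 0"
    and diff: "\<And>w. w > 0 \<Longrightarrow> \<phi> differentiable (at w)"
    and cont: "continuous_on {0<..} (deriv \<phi>)"
    and improves: "improves_on (model n) squared_error
                     (shrink \<phi> :: (real ^ 'p) \<times> real \<Rightarrow> real ^ 'p) fst"
  shows "improves_on (model n) (mse_loss n \<phi>)
           (R0_trunc n \<phi> :: (real ^ 'p) \<times> real \<Rightarrow> real) (R0_hat n \<phi>)"
  unfolding improves_on_def
proof (intro allI impI)
  fix \<theta> :: "real ^ 'p" and \<sigma> :: real assume \<sigma>: "0 < \<sigma>"
  let ?R = "mse n \<phi> \<theta> \<sigma>" and ?p = "real CARD('p)"
  let ?V = "\<lambda>z :: (real ^ 'p) \<times> real. (norm (fst z))\<^sup>2 + snd z"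
  have R: "0 \<le> ?R" "?R \<le> ?p * \<sigma>\<^sup>2"
    using mse_le[OF improves \<sigma> n] by (simp_all add: mse_def)
  define q where "q = (\<lambda>w. ?p / real n - g_fun n CARD('p) \<phi> w + (\<phi> w)\<^sup>2 / w)"
  \<comment> \<open>Since V = s (1 + W), dividing by \<open>1 + w\<close> writes the positive part
    of \<open>R0_hat\<close> as V u(W). The value 0 off the positive half-line keeps
    \<open>u\<close> nonnegative and Borel on the whole line.\<close>
  define u where "u = (\<lambda>w. if w \<in> {0<..} then max (q w) 0 / (1 + w) else 0)"
  have \<phi>: "continuous_on {0<..} \<phi>"
    using diff by (intro differentiable_imp_continuous_on)
      (auto simp: differentiable_on_def intro: differentiable_at_withinI)
  have u[measurable]: "u \<in> borel_measurable borel"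
    unfolding u_def q_def
    by (intro borel_measurable_continuous_on_if continuous_intros continuous_on_max
        continuous_on_g_fun diff cont \<phi>) auto
  have u0: "0 \<le> u w" for w by (simp add: u_def)
  let ?c = "?p / real (n + CARD('p) + 2)"
  have eqs: "?V z * u (W_stat z) = max (R0_hat n \<phi> z) 0 \<and> ?V z * min (u (W_stat z)) ?c = R0_trunc n \<phi> z"
    if z: "fst z \<noteq> 0" "0 < snd z" for z :: "(real ^ 'p) \<times> real"
  proof -
    have W: "0 < W_stat z" using z by (simp add: W_stat_def)
    have V: "?V z = snd z * (1 + W_stat z)" using z by (simp add: W_stat_def field_simps)
    have "R0_hat n \<phi> z = snd z * q (W_stat z)"
      using z by (simp add: R0_hat_def q_def algebra_simps)
    then have "max (R0_hat n \<phi> z) 0 = snd z * max (q (W_stat z)) 0"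
      using z by (simp add: max_mult_distrib_left)
    then have 1: "?V z * u (W_stat z) = max (R0_hat n \<phi> z) 0"
      using W unfolding V u_def by simp
    have "0 \<le> ?V z" unfolding V using W z by simp
    then have "?V z * min (u (W_stat z)) ?c = min (?V z * u (W_stat z)) (?V z * ?c)"
      by (simp only: min_mult_distrib_left if_True)
    also have "?V z * ?c = ?p * snd z * (1 + W_stat z) / (real n + ?p + 2)"
      unfolding V by (simp add: mult_ac)
    finally show ?thesis using 1 by (simp add: R0_trunc_def)
  qed
  have "risk (model n \<theta> \<sigma>) (\<lambda>z. mse_loss n \<phi> \<theta> \<sigma> (R0_trunc n \<phi> z)) =
      (\<integral>\<^sup>+ z. ennreal ((?V z * min (u (W_stat z)) ?c - ?R)\<^sup>2) \<partial>model n \<theta> \<sigma>)"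
    unfolding risk_def mse_loss_def using AE_model_generic[OF \<sigma> n, of \<theta>]
    by (intro nn_integral_cong_AE, eventually_elim) (use eqs in auto)
  also have "\<dots> \<le> (\<integral>\<^sup>+ z. ennreal ((?V z * u (W_stat z) - ?R)\<^sup>2) \<partial>model n \<theta> \<sigma>)"
    by (rule nn_integral_truncation_le[OF \<sigma> n R u u0])
  also have "\<dots> \<le> risk (model n \<theta> \<sigma>) (\<lambda>z. mse_loss n \<phi> \<theta> \<sigma> (R0_hat n \<phi> z))"
    unfolding risk_def mse_loss_def using AE_model_generic[OF \<sigma> n, of \<theta>]
  proof (intro nn_integral_mono_AE, eventually_elim)
    fix z :: "(real ^ 'p) \<times> real" assume z: "fst z \<noteq> 0 \<and> 0 < snd z"
    \<comment> \<open>Replacing a negative estimate by 0 brings it closer to the nonnegative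
      target.\<close>
    have "(max (R0_hat n \<phi> z) 0 - ?R)\<^sup>2 \<le> (R0_hat n \<phi> z - ?R)\<^sup>2"
      using R by (subst abs_le_square_iff[symmetric]) (auto simp: max_def)
    then show "ennreal ((?V z * u (W_stat z) - ?R)\<^sup>2) \<le> ennreal ((R0_hat n \<phi> z - ?R)\<^sup>2)"
      using eqs z by (simp add: ennreal_leI)
  qed
  finally show "risk (model n \<theta> \<sigma>) (\<lambda>z. mse_loss n \<phi> \<theta> \<sigma> (R0_trunc n \<phi> z))
      \<le> risk (model n \<theta> \<sigma>) (\<lambda>z. mse_loss n \<phi> \<theta> \<sigma> (R0_hat n \<phi> z))" .
qed

text \<open>The \<open>psi0\<close> form is tied to positive \<open>a_fun\<close>: at value 0 the
  convention \<open>1 / 0 = 0\<close> switches off the truncation, and for negative values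
  multiplication by \<open>a_fun\<close> exchanges max and min. The min-max form
  \<open>R0_trunc\<close> is therefore compared separately.\<close>

theorem theorem1:
  fixes \<phi> :: "real \<Rightarrow> real" and n :: nat
  assumes p: "CARD('p::finite) \<ge> 3" and n: "n > 0"
    and diff: "\<And>w. w > 0 \<Longrightarrow> \<phi> differentiable (at w)"
    and cont: "continuous_on {0<..} (deriv \<phi>)"
    and improves: "improves_on (model n) squared_error
                     (shrink \<phi> :: (real ^ 'p) \<times> real \<Rightarrow> real ^ 'p) fst"
  shows "(\<forall>z :: (real ^ 'p) \<times> real.
            fst z \<noteq> 0 \<and> snd z > 0 \<and> a_fun n CARD('p) \<phi> (W_stat z) > 0 \<longrightarrow>
            R_hat n \<phi> (psi0 n CARD('p) \<phi>) z = R0_trunc n \<phi> z)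
       \<and> improves_on (model n) (mse_loss n \<phi>)
           (R0_trunc n \<phi> :: (real ^ 'p) \<times> real \<Rightarrow> real) (R0_hat n \<phi>)
       \<and> ((\<forall>\<theta> :: real ^ 'p. \<forall>\<sigma>>0. AE z in model n \<theta> \<sigma>. a_fun n CARD('p) \<phi> (W_stat z) > 0) \<longrightarrow>
          improves_on (model n) (mse_loss n \<phi>)
            (R_hat n \<phi> (psi0 n CARD('p) \<phi>) :: (real ^ 'p) \<times> real \<Rightarrow> real) (R0_hat n \<phi>))"
proof (intro conjI impI)
  show trunc: "improves_on (model n) (mse_loss n \<phi>)
      (R0_trunc n \<phi> :: (real ^ 'p) \<times> real \<Rightarrow> real) (R0_hat n \<phi>)"
    by (rule R0_trunc_improves[OF n diff cont improves])
  assume a: "\<forall>\<theta> :: real ^ 'p. \<forall>\<sigma>>0. AE z in model n \<theta> \<sigma>. a_fun n CARD('p) \<phi> (W_stat z) > 0"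
  \<comment> \<open>Under the almost sure positivity the two forms agree off a null set, so their
    risks are equal.\<close>
  have "risk (model n \<theta> \<sigma>) (\<lambda>z. mse_loss n \<phi> \<theta> \<sigma> (R_hat n \<phi> (psi0 n CARD('p) \<phi>) z)) =
      risk (model n \<theta> \<sigma>) (\<lambda>z. mse_loss n \<phi> \<theta> \<sigma> (R0_trunc n \<phi> z))"
    if \<sigma>: "0 < \<sigma>" for \<theta> :: "real ^ 'p" and \<sigma>
    unfolding risk_def using AE_model_generic[OF \<sigma> n, of \<theta>] a[rule_format, OF \<sigma>, of \<theta>]
    by (intro nn_integral_cong_AE, eventually_elim) (simp add: R_hat_psi0_eq[OF n])
  then show "improves_on (model n) (mse_loss n \<phi>)
      (R_hat n \<phi> (psi0 n CARD('p) \<phi>) :: (real ^ 'p) \<times> real \<Rightarrow> real) (R0_hat n \<phi>)"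
    using trunc unfolding improves_on_def by metis
qed (use R_hat_psi0_eq[OF n] in blast)

end
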